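(* Let $m\ge 1$ and let $b\in P_m$ be a pure $m$-braid with (unreduced) Burau matrix $f(b)$. Then the integer matrix $\left.\frac{d}{dt}f(b)\right|_{t=1}$ is symmetric.
   Context: $B_m$ is the braid group with Artin generators $\sigma_1,\dots,\sigma_{m-1}$ and relations $\sigma_i\sigma_{i+1}\sigma_i=\sigma_{i+1}\sigma_i\sigma_{i+1}$ ($1\le i\le m-2$), $\sigma_i\sigma_j=\sigma_j\sigma_i$ ($|i-j|>1$). $P_m\subset B_m$ is the pure braid group, i.e. the kernel of the homomorphism $B_m\to S_m$, $\sigma_i\mapsto(i\ i+1)$. Let $\Lambda=\mathbb{Z}[t,t^{-1}]$. The (unreduced) Burau representation is the group homomorphism $f:B_m\to GL_m(\Lambda)$ with $$f(\sigma_i)=I_{i-1}\oplus\begin{bmatrix}1-t&1\\ t&0\end{bmatrix}\oplus I_{m-i-1}\quad(1\le i\le m-1).$$ For $f(b)=[f_{ij}(b;t)]$, $\frac{d}{dt}f(b)=\left[\frac{d}{dt}f_{ij}(b;t)\right]$ (entrywise derivative), and $|_{t=1}$ denotes entrywise evaluation. *)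

theory Defs
  imports
    "HOL-Algebra.Sym_Groups"
    "HOL-Library.Poly_Mapping"
    "Jordan_Normal_Form.Matrix"
begin

text \<open>A letter \<open>(x, True)\<close> stands for the generator \<open>x\<close>, and \<open>(x, False)\<close> for its inverse.\<close>

type_synonym 'a gword = "('a \<times> bool) list"

definition gwords :: "'a set \<Rightarrow> 'a gword set" where
  "gwords X = lists (X \<times> UNIV)"

inductive_set pres_cong :: "'a set \<Rightarrow> ('a gword \<times> 'a gword) set \<Rightarrow> ('a gword \<times> 'a gword) set"
  for X :: "'a set" and R :: "('a gword \<times> 'a gword) set"
where
  refl: "w \<in> gwords X \<Longrightarrow> (w, w) \<in> pres_cong X R"
| sym: "(u, v) \<in> pres_cong X R \<Longrightarrow> (v, u) \<in> pres_cong X R"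
| trans: "(u, v) \<in> pres_cong X R \<Longrightarrow> (v, w) \<in> pres_cong X R \<Longrightarrow> (u, w) \<in> pres_cong X R"
| append: "(u, u') \<in> pres_cong X R \<Longrightarrow> (v, v') \<in> pres_cong X R \<Longrightarrow> (u @ v, u' @ v') \<in> pres_cong X R"
| cancel: "x \<in> X \<Longrightarrow> ([(x, e), (x, \<not> e)], []) \<in> pres_cong X R"
| relation: "(u, v) \<in> R \<Longrightarrow> u \<in> gwords X \<Longrightarrow> v \<in> gwords X \<Longrightarrow> (u, v) \<in> pres_cong X R"

definition presented_group :: "'a set \<Rightarrow> ('a gword \<times> 'a gword) set \<Rightarrow> 'a gword set monoid" where
  "presented_group X R = \<lparr>
     carrier = gwords X // pres_cong X R,
     mult = (\<lambda>A B. \<Union>u\<in>A. \<Union>v\<in>B. pres_cong X R `` {u @ v}),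
     one = pres_cong X R `` {[]} \<rparr>"

definition presented_gen :: "'a set \<Rightarrow> ('a gword \<times> 'a gword) set \<Rightarrow> 'a \<Rightarrow> 'a gword set" where
  "presented_gen X R x = pres_cong X R `` {[(x, True)]}"

fun gword_eval :: "('b, 'c) monoid_scheme \<Rightarrow> ('a \<Rightarrow> 'b) \<Rightarrow> 'a gword \<Rightarrow> 'b" where
  "gword_eval H g [] = \<one>\<^bsub>H\<^esub>"
| "gword_eval H g ((x, e) # w) = (if e then g x else inv\<^bsub>H\<^esub> (g x)) \<otimes>\<^bsub>H\<^esub> gword_eval H g w"

text \<open>The map out of a presented group that extends \<open>g\<close> on the generators. It is meaningful
  only if \<open>g\<close> respects the relations, so that the image below is a singleton; see
  \<open>presented_lift_hom\<close> and \<open>presented_lift_gen\<close>.\<close>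

definition presented_lift :: "('b, 'c) monoid_scheme \<Rightarrow> ('a \<Rightarrow> 'b) \<Rightarrow> 'a gword set \<Rightarrow> 'b" where
  "presented_lift H g A = the_elem (gword_eval H g ` A)"

lemma pres_cong_words: "(u, v) \<in> pres_cong X R \<Longrightarrow> u \<in> gwords X \<and> v \<in> gwords X"
  by (induction rule: pres_cong.induct) (auto simp: gwords_def)

lemma equiv_pres_cong: "equiv (gwords X) (pres_cong X R)"
proof (rule equivI)
  show "pres_cong X R \<subseteq> gwords X \<times> gwords X"
    using pres_cong_words by fast
  show "refl_on (gwords X) (pres_cong X R)"
    by (simp add: refl_on_def pres_cong.refl)
  show "sym (pres_cong X R)"
    by (rule symI) (rule pres_cong.sym)
  show "trans (pres_cong X R)"
    by (rule transI) (rule pres_cong.trans)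
qed

lemma pres_class_eq:
  "(u, v) \<in> pres_cong X R \<Longrightarrow> pres_cong X R `` {u} = pres_cong X R `` {v}"
  using equiv_class_eq equiv_pres_cong by metis

lemma presented_group_carrier_iff:
  "A \<in> carrier (presented_group X R) \<longleftrightarrow> (\<exists>u \<in> gwords X. A = pres_cong X R `` {u})"
  by (auto simp: presented_group_def quotient_def)

lemma presented_group_mult_class:
  assumes "u \<in> gwords X" "v \<in> gwords X"
  shows "pres_cong X R `` {u} \<otimes>\<^bsub>presented_group X R\<^esub> pres_cong X R `` {v} = pres_cong X R `` {u @ v}"
proof -
  have "pres_cong X R `` {u' @ v'} = pres_cong X R `` {u @ v}"
    if "u' \<in> pres_cong X R `` {u}" "v' \<in> pres_cong X R `` {v}" for u' v'
  proof -
    have "(u' @ v', u @ v) \<in> pres_cong X R"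
      using that by (intro pres_cong.append) (simp_all add: pres_cong.sym)
    then show ?thesis by (rule pres_class_eq)
  qed
  moreover have "u \<in> pres_cong X R `` {u}" "v \<in> pres_cong X R `` {v}"
    using assms by (auto intro: pres_cong.refl)
  moreover have "pres_cong X R `` {u} \<otimes>\<^bsub>presented_group X R\<^esub> pres_cong X R `` {v}
      = (\<Union>u'\<in>pres_cong X R `` {u}. \<Union>v'\<in>pres_cong X R `` {v}. pres_cong X R `` {u' @ v'})"
    by (simp add: presented_group_def)
  ultimately show ?thesis
    by (metis (no_types, lifting) SUP_eq_const empty_iff)
qed

lemma presented_group_one: "\<one>\<^bsub>presented_group X R\<^esub> = pres_cong X R `` {[]}"
  by (simp add: presented_group_def)

lemma gwords_append: "u \<in> gwords X \<Longrightarrow> v \<in> gwords X \<Longrightarrow> u @ v \<in> gwords X"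
  by (auto simp: gwords_def)

lemma gwords_Nil: "[] \<in> gwords X"
  by (simp add: gwords_def)

lemma pres_cong_inverse:
  "w \<in> gwords X \<Longrightarrow> (rev (map (\<lambda>(x, e). (x, \<not> e)) w) @ w, []) \<in> pres_cong X R
    \<and> rev (map (\<lambda>(x, e). (x, \<not> e)) w) \<in> gwords X"
proof (induction w)
  case Nil
  then show ?case by (auto simp: gwords_Nil intro: pres_cong.refl)
next
  case (Cons l w)
  obtain x e where l: "l = (x, e)" by force
  let ?w' = "rev (map (\<lambda>(x, e). (x, \<not> e)) w)"
  have x: "x \<in> X" and w: "w \<in> gwords X" using Cons.prems l by (auto simp: gwords_def)
  have w': "?w' \<in> gwords X" and ww: "(?w' @ w, []) \<in> pres_cong X R" using Cons.IH w by auto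
  have "([(x, \<not> e), (x, \<not> \<not> e)], []) \<in> pres_cong X R" by (rule pres_cong.cancel[OF x])
  then have "([(x, \<not> e), (x, e)] @ w, [] @ w) \<in> pres_cong X R"
    using pres_cong.append pres_cong.refl[OF w] by fastforce
  then have "(?w' @ [(x, \<not> e), (x, e)] @ w, ?w' @ [] @ w) \<in> pres_cong X R"
    using pres_cong.append pres_cong.refl[OF w'] by fastforce
  then have "(?w' @ [(x, \<not> e), (x, e)] @ w, []) \<in> pres_cong X R"
    using ww by (metis append_Nil pres_cong.trans)
  then show ?case using w' x by (simp add: l) (auto simp: gwords_def)
qed

lemma presented_group_group: "group (presented_group X R)"
proof (rule groupI)
  fix A B C
  assume "A \<in> carrier (presented_group X R)" "B \<in> carrier (presented_group X R)"
    "C \<in> carrier (presented_group X R)"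
  then show "A \<otimes>\<^bsub>presented_group X R\<^esub> B \<otimes>\<^bsub>presented_group X R\<^esub> C
      = A \<otimes>\<^bsub>presented_group X R\<^esub> (B \<otimes>\<^bsub>presented_group X R\<^esub> C)"
    by (auto simp: presented_group_carrier_iff presented_group_mult_class gwords_append)
next
  fix A assume "A \<in> carrier (presented_group X R)"
  then obtain u where u: "u \<in> gwords X" "A = pres_cong X R `` {u}"
    by (auto simp: presented_group_carrier_iff)
  let ?v = "rev (map (\<lambda>(x, e). (x, \<not> e)) u)"
  have "pres_cong X R `` {?v} \<otimes>\<^bsub>presented_group X R\<^esub> A = \<one>\<^bsub>presented_group X R\<^esub>"
    using pres_cong_inverse[OF u(1), of R] pres_class_eq u
    by (metis presented_group_mult_class presented_group_one)
  then show "\<exists>B\<in>carrier (presented_group X R). B \<otimes>\<^bsub>presented_group X R\<^esub> A = \<one>\<^bsub>presented_group X R\<^esub>"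
    using pres_cong_inverse[OF u(1), of R] by (meson presented_group_carrier_iff)
next
  show "\<one>\<^bsub>presented_group X R\<^esub> \<in> carrier (presented_group X R)"
    using gwords_Nil by (metis presented_group_carrier_iff presented_group_one)
next
  fix A B
  assume "A \<in> carrier (presented_group X R)" "B \<in> carrier (presented_group X R)"
  then show "A \<otimes>\<^bsub>presented_group X R\<^esub> B \<in> carrier (presented_group X R)"
    by (metis presented_group_carrier_iff presented_group_mult_class gwords_append)
next
  fix A assume "A \<in> carrier (presented_group X R)"
  then show "\<one>\<^bsub>presented_group X R\<^esub> \<otimes>\<^bsub>presented_group X R\<^esub> A = A"
    by (auto simp: presented_group_carrier_iff presented_group_one presented_group_mult_class gwords_Nil)
qed

lemma gword_eval_closed:
  assumes "group H" "\<And>x. x \<in> X \<Longrightarrow> g x \<in> carrier H" "w \<in> gwords X"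
  shows "gword_eval H g w \<in> carrier H"
proof -
  interpret group H by fact
  show ?thesis using assms(3)
    by (induction w) (auto simp: gwords_def assms(2))
qed

lemma gword_eval_append:
  assumes "group H" "\<And>x. x \<in> X \<Longrightarrow> g x \<in> carrier H" "u \<in> gwords X" "v \<in> gwords X"
  shows "gword_eval H g (u @ v) = gword_eval H g u \<otimes>\<^bsub>H\<^esub> gword_eval H g v"
proof -
  interpret group H by fact
  note cl = gword_eval_closed[OF assms(1), of X g, OF assms(2)]
  show ?thesis using assms(3)
  proof (induction u)
    case Nil
    then show ?case using cl[OF _ assms(4)] by simp
  next
    case (Cons l u)
    obtain x e where l: "l = (x, e)" by force
    have x: "x \<in> X" and u: "u \<in> gwords X" using Cons.prems l by (auto simp: gwords_def)
    have "gword_eval H g u \<in> carrier H" "gword_eval H g v \<in> carrier H"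
      using cl[OF _ u] cl[OF _ assms(4)] by auto
    then show ?case using Cons.IH[OF u] assms(2)[OF x] by (simp add: l m_assoc)
  qed
qed

lemma gword_eval_cong:
  assumes "group H" "\<And>x. x \<in> X \<Longrightarrow> g x \<in> carrier H"
    and "\<And>u v. (u, v) \<in> R \<Longrightarrow> gword_eval H g u = gword_eval H g v"
    and "(u, v) \<in> pres_cong X R"
  shows "gword_eval H g u = gword_eval H g v"
proof -
  interpret group H by fact
  show ?thesis using assms(4)
  proof (induction rule: pres_cong.induct)
    case (append u u' v v')
    then show ?case
      using gword_eval_append[OF assms(1), of X g, OF assms(2)] pres_cong_words
      by metis
  next
    case (cancel x e)
    then show ?case using assms(2)[OF cancel] by simp
  qed (use assms(3) in auto)
qed

lemma presented_lift_class:
  assumes "group H" "\<And>x. x \<in> X \<Longrightarrow> g x \<in> carrier H"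
    and "\<And>u v. (u, v) \<in> R \<Longrightarrow> gword_eval H g u = gword_eval H g v"
    and "w \<in> gwords X"
  shows "presented_lift H g (pres_cong X R `` {w}) = gword_eval H g w"
proof -
  have "gword_eval H g ` (pres_cong X R `` {w}) = {gword_eval H g w}"
    using gword_eval_cong[OF assms(1), of X g R, OF assms(2,3)] pres_cong.refl[OF assms(4)]
    by (auto simp: image_iff)
  then show ?thesis by (simp add: presented_lift_def)
qed

lemma presented_lift_hom:
  assumes "group H" "\<And>x. x \<in> X \<Longrightarrow> g x \<in> carrier H"
    and "\<And>u v. (u, v) \<in> R \<Longrightarrow> gword_eval H g u = gword_eval H g v"
  shows "presented_lift H g \<in> hom (presented_group X R) H"
proof (rule homI)
  note lift = presented_lift_class[OF assms(1), of X g R, OF assms(2,3)]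
  fix A B assume "A \<in> carrier (presented_group X R)" "B \<in> carrier (presented_group X R)"
  then obtain u v where uv: "u \<in> gwords X" "A = pres_cong X R `` {u}"
    "v \<in> gwords X" "B = pres_cong X R `` {v}"
    by (auto simp: presented_group_carrier_iff)
  show "presented_lift H g A \<in> carrier H"
    using uv lift[of u] gword_eval_closed[OF assms(1), of X g, OF assms(2)] by simp
  show "presented_lift H g (A \<otimes>\<^bsub>presented_group X R\<^esub> B) = presented_lift H g A \<otimes>\<^bsub>H\<^esub> presented_lift H g B"
    using uv lift gword_eval_append[OF assms(1), of X g, OF assms(2)]
    by (simp add: presented_group_mult_class gwords_append)
qed

lemma presented_lift_gen:
  assumes "group H" "\<And>x. x \<in> X \<Longrightarrow> g x \<in> carrier H"
    and "\<And>u v. (u, v) \<in> R \<Longrightarrow> gword_eval H g u = gword_eval H g v"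
    and "x \<in> X"
  shows "presented_lift H g (presented_gen X R x) = g x"
proof -
  interpret group H by fact
  show ?thesis
    using presented_lift_class[OF assms(1), of X g R "[(x, True)]", OF assms(2,3)] assms(2,4)
    by (simp add: presented_gen_def gwords_def)
qed


definition braid_relations :: "nat \<Rightarrow> (nat gword \<times> nat gword) set" where
  "braid_relations m =
     {([(i, True), (i + 1, True), (i, True)], [(i + 1, True), (i, True), (i + 1, True)]) | i.
        1 \<le> i \<and> i + 2 \<le> m}
   \<union> {([(i, True), (j, True)], [(j, True), (i, True)]) | i j.
        i \<in> {1..<m} \<and> j \<in> {1..<m} \<and> (i + 1 < j \<or> j + 1 < i)}"

definition braid_group :: "nat \<Rightarrow> nat gword set monoid" where
  "braid_group m = presented_group {1..<m} (braid_relations m)"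

definition artin_gen :: "nat \<Rightarrow> nat \<Rightarrow> nat gword set" where
  "artin_gen m = presented_gen {1..<m} (braid_relations m)"

definition braid_perm :: "nat \<Rightarrow> nat gword set \<Rightarrow> nat \<Rightarrow> nat" where
  "braid_perm m = presented_lift (sym_group m) (\<lambda>i. Transposition.transpose i (i + 1))"

definition pure_braid_group :: "nat \<Rightarrow> nat gword set set" where
  "pure_braid_group m = kernel (braid_group m) (sym_group m) (braid_perm m)"

lemma braid_group_group: "group (braid_group m)"
  by (simp add: braid_group_def presented_group_group)

lemma transpose_in_sym_group:
  "i \<in> {1..<m} \<Longrightarrow> Transposition.transpose i (i + 1) \<in> carrier (sym_group m)"
  by (auto simp: sym_group_carrier intro: permutes_swap_id)

lemma transpose_braid_relations:
  assumes "(u, v) \<in> braid_relations m"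
  shows "gword_eval (sym_group m) (\<lambda>i. Transposition.transpose i (i + 1)) u
       = gword_eval (sym_group m) (\<lambda>i. Transposition.transpose i (i + 1)) v"
proof (rule ext)
  fix k
  have 1: "gword_eval (sym_group m) (\<lambda>i. Transposition.transpose i (i + 1)) [(i, True), (i + 1, True), (i, True)] k
      = gword_eval (sym_group m) (\<lambda>i. Transposition.transpose i (i + 1)) [(i + 1, True), (i, True), (i + 1, True)] k" for i
    by (cases "k = i"; cases "k = i + 1"; cases "k = i + 2")
      (simp_all add: sym_group_mult sym_group_one Transposition.transpose_def)
  have 2: "gword_eval (sym_group m) (\<lambda>i. Transposition.transpose i (i + 1)) [(i, True), (j, True)] k
      = gword_eval (sym_group m) (\<lambda>i. Transposition.transpose i (i + 1)) [(j, True), (i, True)] k"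
    if "i + 1 < j \<or> j + 1 < i" for i j
    using that
    by (cases "k = i \<or> k = i + 1"; cases "k = j \<or> k = j + 1")
      (auto simp: sym_group_mult sym_group_one Transposition.transpose_def)
  show "gword_eval (sym_group m) (\<lambda>i. Transposition.transpose i (i + 1)) u k
      = gword_eval (sym_group m) (\<lambda>i. Transposition.transpose i (i + 1)) v k"
    using assms 1 2 unfolding braid_relations_def by blast
qed

lemma braid_perm_hom: "braid_perm m \<in> hom (braid_group m) (sym_group m)"
  unfolding braid_perm_def braid_group_def
  by (rule presented_lift_hom[OF sym_group_is_group], erule transpose_in_sym_group, erule transpose_braid_relations)

lemma braid_perm_artin_gen:
  "i \<in> {1..<m} \<Longrightarrow> braid_perm m (artin_gen m i) = Transposition.transpose i (i + 1)"
  unfolding braid_perm_def artin_gen_def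
  by (rule presented_lift_gen[OF sym_group_is_group], erule transpose_in_sym_group, erule transpose_braid_relations, assumption)


text \<open>The ring \<open>Z[t, t^-1]\<close> is the group ring of the additive group of the integers: the
  coefficient of \<open>t^k\<close> in \<open>p\<close> is \<open>lookup p k\<close>, and multiplication is convolution.\<close>

type_synonym laurent = "int \<Rightarrow>\<^sub>0 int"

definition laurent_t :: laurent where
  "laurent_t = Poly_Mapping.single 1 1"

definition laurent_deriv :: "laurent \<Rightarrow> laurent" where
  "laurent_deriv p = (\<Sum>k\<in>Poly_Mapping.keys p. Poly_Mapping.single (k - 1) (k * Poly_Mapping.lookup p k))"

text \<open>Evaluation at \<open>t = 1\<close>: every power of \<open>t\<close> contributes its coefficient.\<close>

definition laurent_eval_1 :: "laurent \<Rightarrow> int" where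
  "laurent_eval_1 p = (\<Sum>k\<in>Poly_Mapping.keys p. Poly_Mapping.lookup p k)"

lemma laurent_deriv_single:
  "laurent_deriv (Poly_Mapping.single k c) = Poly_Mapping.single (k - 1) (k * c)"
  by (simp add: laurent_deriv_def)

lemma laurent_deriv_add: "laurent_deriv (p + q) = laurent_deriv p + laurent_deriv q"
proof -
  let ?K = "Poly_Mapping.keys p \<union> Poly_Mapping.keys q"
  have *: "laurent_deriv r = (\<Sum>k\<in>?K. Poly_Mapping.single (k - 1) (k * Poly_Mapping.lookup r k))"
    if "Poly_Mapping.keys r \<subseteq> ?K" for r
    unfolding laurent_deriv_def using that
    by (intro sum.mono_neutral_left) (auto simp: in_keys_iff)
  show ?thesis
    using Poly_Mapping.keys_add[of p q]
    by (simp add: * lookup_add distrib_left single_add sum.distrib)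
qed

lemma laurent_eval_1_single: "laurent_eval_1 (Poly_Mapping.single k c) = c"
  by (simp add: laurent_eval_1_def)

lemma laurent_eval_1_add: "laurent_eval_1 (p + q) = laurent_eval_1 p + laurent_eval_1 q"
proof -
  let ?K = "Poly_Mapping.keys p \<union> Poly_Mapping.keys q"
  have *: "laurent_eval_1 r = (\<Sum>k\<in>?K. Poly_Mapping.lookup r k)"
    if "Poly_Mapping.keys r \<subseteq> ?K" for r
    unfolding laurent_eval_1_def using that
    by (intro sum.mono_neutral_left) (auto simp: in_keys_iff)
  show ?thesis
    using Poly_Mapping.keys_add[of p q]
    by (simp add: * lookup_add sum.distrib)
qed


definition GL :: "nat \<Rightarrow> laurent mat monoid" where
  "GL m = units_of (ring_mat TYPE(laurent) m ())"

definition burau_gen :: "nat \<Rightarrow> nat \<Rightarrow> laurent mat" where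
  "burau_gen m i = diag_block_mat
     [1\<^sub>m (i - 1), mat_of_rows_list 2 [[1 - laurent_t, 1], [laurent_t, 0]], 1\<^sub>m (m - i - 1)]"

definition burau :: "nat \<Rightarrow> nat gword set \<Rightarrow> laurent mat" where
  "burau m = presented_lift (GL m) (burau_gen m)"

lemma monoid_ring_mat: "monoid (ring_mat TYPE(laurent) m ())"
  by (rule semiring.axioms(2)[OF semiring_mat])

lemma GL_group: "group (GL m)"
  unfolding GL_def by (rule monoid.units_group[OF monoid_ring_mat])

lemma burau_gen_carrier: "i \<in> {1..<m} \<Longrightarrow> burau_gen m i \<in> carrier_mat m m"
  by (auto simp: burau_gen_def Let_def mat_of_rows_list_def intro!: carrier_matI)

lemma burau_gen_index:
  assumes "i \<in> {1..<m}" "r < m" "c < m"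
  shows "burau_gen m i $$ (r, c) =
    (if r = i - 1 then (if c = i - 1 then 1 - laurent_t else if c = i then 1 else 0)
     else if r = i then (if c = i - 1 then laurent_t else 0)
     else if r = c then 1 else 0)"
proof -
  obtain p where i: "i = Suc p" using assms(1) by (cases i) auto
  obtain q where m: "m = p + (2 + q)"
  proof
    show "m = p + (2 + (m - p - 2))" using assms(1) i by auto
  qed
  let ?B = "mat_of_rows_list 2 [[1 - laurent_t, 1], [laurent_t, 0]]"
  have z: "four_block_mat (1\<^sub>m q) (0\<^sub>m q 0) (0\<^sub>m 0 q) (0\<^sub>m 0 0) = (1\<^sub>m q :: laurent mat)"
    by (intro eq_matI) auto
  have dB: "dim_row ?B = 2" "dim_col ?B = 2" by (simp_all add: mat_of_rows_list_def)
  have B: "?B $$ (0, 0) = 1 - laurent_t" "?B $$ (0, Suc 0) = 1"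
    "?B $$ (Suc 0, 0) = laurent_t" "?B $$ (Suc 0, Suc 0) = 0"
    by (simp_all add: mat_of_rows_list_def)
  define D where "D = four_block_mat ?B (0\<^sub>m 2 q) (0\<^sub>m q 2) (1\<^sub>m q)"
  have dD: "dim_row D = 2 + q" "dim_col D = 2 + q" by (simp_all add: D_def dB)
  have D: "D $$ (r, c) = (if r < 2 then (if c < 2 then ?B $$ (r, c) else 0)
      else if r = c then 1 else 0)" if "r < 2 + q" "c < 2 + q" for r c
    using that unfolding D_def
    by (subst index_mat_four_block) (auto simp: dB)
  have g: "burau_gen m i = four_block_mat (1\<^sub>m p) (0\<^sub>m p (2 + q)) (0\<^sub>m (2 + q) p) D"
    by (simp add: burau_gen_def i m Let_def z dB dD flip: D_def)
  have G: "burau_gen m i $$ (r, c) = (if r < p then (if r = c then 1 else 0)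
      else if c < p then 0 else D $$ (r - p, c - p))"
    unfolding g using assms(2,3) m by (subst index_mat_four_block) (auto simp: dD)
  show ?thesis
  proof (cases "r < p \<or> c < p")
    case True
    then show ?thesis unfolding G using i by auto
  next
    case False
    then obtain r' c' where rc: "r = p + r'" "c = p + c'"
      by (metis le_iff_add not_le)
    have "r' < 2 + q" "c' < 2 + q" using assms(2,3) rc m by auto
    then have "burau_gen m i $$ (r, c) = (if r' < 2 then (if c' < 2 then ?B $$ (r', c') else 0)
      else if r' = c' then 1 else 0)"
      unfolding G unfolding rc by (simp add: D)
    moreover have "r' = 0 \<or> r' = Suc 0 \<or> 2 \<le> r'" "c' = 0 \<or> c' = Suc 0 \<or> 2 \<le> c'" by auto
    ultimately show ?thesis
      unfolding rc i by (elim disjE) (simp_all add: B)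
  qed
qed

lemma burau_gen_mult_index:
  assumes i: "i \<in> {1..<m}" and A: "A \<in> carrier_mat m m" and r: "r < m" and c: "c < m"
  shows "(burau_gen m i * A) $$ (r, c) =
    (if r = i - 1 then (1 - laurent_t) * A $$ (i - 1, c) + A $$ (i, c)
     else if r = i then laurent_t * A $$ (i - 1, c)
     else A $$ (r, c))"
proof -
  have im: "i - 1 < m" "i < m" "i - 1 \<noteq> i" using i by auto
  have "(burau_gen m i * A) $$ (r, c) = (\<Sum>k = 0..<m. burau_gen m i $$ (r, k) * A $$ (k, c))"
    using A r c burau_gen_carrier[OF i] by (simp add: scalar_prod_def)
  also have "\<dots> = (\<Sum>k = 0..<m.
      (if k = i - 1 then (if r = i - 1 then 1 - laurent_t else if r = i then laurent_t else 0) * A $$ (k, c) else 0)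
      + (if k = i then (if r = i - 1 then 1 else 0) * A $$ (k, c) else 0)
      + (if k = r then (if r = i - 1 \<or> r = i then 0 else 1) * A $$ (k, c) else 0))"
    using im by (intro sum.cong refl) (auto simp: burau_gen_index[OF i r])
  also have "\<dots> = (if r = i - 1 then 1 - laurent_t else if r = i then laurent_t else 0) * A $$ (i - 1, c)
      + (if r = i - 1 then 1 else 0) * A $$ (i, c)
      + (if r = i - 1 \<or> r = i then 0 else 1) * A $$ (r, c)"
    using im r by (simp add: sum.distrib)
  finally show ?thesis using im by auto
qed

lemma laurent_t_inverse: "laurent_t * Poly_Mapping.single (- 1) 1 = 1"
  by (simp add: laurent_t_def mult_single)

lemma burau_gen_GL:
  assumes i: "i \<in> {1..<m}"
  shows "burau_gen m i \<in> carrier (GL m)"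
proof -
  let ?s = "Poly_Mapping.single (- 1) 1 :: laurent"
  define B where "B = mat m m (\<lambda>(r, c).
     if r = i - 1 then (if c = i then ?s else 0)
     else if r = i then (if c = i - 1 then 1 else if c = i then 1 - ?s else 0)
     else if r = c then 1 else (0 :: laurent))"
  have Bi: "B $$ (r, c) =
     (if r = i - 1 then (if c = i then ?s else 0)
     else if r = i then (if c = i - 1 then 1 else if c = i then 1 - ?s else 0)
     else if r = c then 1 else 0)" if "r < m" "c < m" for r c
    using that by (simp add: B_def)
  have B: "B \<in> carrier_mat m m" by (simp add: B_def)
  have im: "i - 1 < m" "i < m" "i - 1 \<noteq> i" using i by auto
  have ts: "laurent_t * ?s = 1" "?s * laurent_t = 1"
    using laurent_t_inverse by (simp_all add: mult.commute)
  have 1: "burau_gen m i * B = 1\<^sub>m m"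
    using burau_gen_carrier[OF i] im B ts
    by (intro eq_matI)
      (auto simp: burau_gen_mult_index[OF i B] Bi algebra_simps simp del: index_mult_mat(1))
  have 2: "B * burau_gen m i = 1\<^sub>m m"
  proof (rule eq_matI)
    fix r c assume rc: "r < dim_row (1\<^sub>m m :: laurent mat)" "c < dim_col (1\<^sub>m m :: laurent mat)"
    have "(B * burau_gen m i) $$ (r, c) = (\<Sum>k = 0..<m. B $$ (r, k) * burau_gen m i $$ (k, c))"
      using B rc burau_gen_carrier[OF i] by (simp add: scalar_prod_def)
    also have "\<dots> = (\<Sum>k = 0..<m.
      (if k = i - 1 then (if r = i then 1 else 0) * burau_gen m i $$ (k, c) else 0)
      + (if k = i then (if r = i - 1 then ?s else if r = i then 1 - ?s else 0) * burau_gen m i $$ (k, c) else 0)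
      + (if k = r then (if r = i - 1 \<or> r = i then 0 else 1) * burau_gen m i $$ (k, c) else 0))"
      using im rc by (intro sum.cong refl) (auto simp: Bi)
    also have "\<dots> = (if r = i then 1 else 0) * burau_gen m i $$ (i - 1, c)
      + (if r = i - 1 then ?s else if r = i then 1 - ?s else 0) * burau_gen m i $$ (i, c)
      + (if r = i - 1 \<or> r = i then 0 else 1) * burau_gen m i $$ (r, c)"
      using im rc by (simp add: sum.distrib)
    also have "\<dots> = (1\<^sub>m m :: laurent mat) $$ (r, c)"
      using im rc ts by (auto simp: burau_gen_index[OF i] algebra_simps)
    finally show "(B * burau_gen m i) $$ (r, c) = (1\<^sub>m m :: laurent mat) $$ (r, c)" .
  qed (use B burau_gen_carrier[OF i] in auto)
  show ?thesis
    using 1 2 B burau_gen_carrier[OF i]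
    by (auto simp: GL_def units_of_carrier Units_def ring_mat_simps)
qed

lemma burau_braid_relations:
  assumes "(u, v) \<in> braid_relations m"
  shows "gword_eval (GL m) (burau_gen m) u = gword_eval (GL m) (burau_gen m) v"
  using assms unfolding braid_relations_def
proof (elim UnE)
  assume "(u, v) \<in> {([(i, True), (i + 1, True), (i, True)], [(i + 1, True), (i, True), (i + 1, True)]) | i.
        1 \<le> i \<and> i + 2 \<le> m}"
  then obtain i where uv: "u = [(i, True), (i + 1, True), (i, True)]"
      "v = [(i + 1, True), (i, True), (i + 1, True)]"
    and im: "1 \<le> i" "i + 2 \<le> m" by blast
  have i: "i \<in> {1..<m}" "i + 1 \<in> {1..<m}" using im by auto
  note c = burau_gen_carrier[OF i(1)] burau_gen_carrier[OF i(2)]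
  have "burau_gen m i * (burau_gen m (i + 1) * burau_gen m i)
      = burau_gen m (i + 1) * (burau_gen m i * burau_gen m (i + 1))"
    using c im
    by (intro eq_matI)
      (auto simp: burau_gen_mult_index[OF i(1)] burau_gen_mult_index[OF i(2), simplified]
         burau_gen_index[OF i(1)] burau_gen_index[OF i(2), simplified] algebra_simps
         simp del: index_mult_mat(1))
  then show ?thesis using c
    by (simp add: uv GL_def units_of_mult units_of_one ring_mat_simps)
next
  assume "(u, v) \<in> {([(i, True), (j, True)], [(j, True), (i, True)]) | i j.
        i \<in> {1..<m} \<and> j \<in> {1..<m} \<and> (i + 1 < j \<or> j + 1 < i)}"
  then obtain i j where uv: "u = [(i, True), (j, True)]" "v = [(j, True), (i, True)]"
    and ij: "i \<in> {1..<m}" "j \<in> {1..<m}" "i + 1 < j \<or> j + 1 < i" by blast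
  note c = burau_gen_carrier[OF ij(1)] burau_gen_carrier[OF ij(2)]
  have "burau_gen m i * burau_gen m j = burau_gen m j * burau_gen m i"
  proof (rule eq_matI)
    fix r k assume "r < dim_row (burau_gen m j * burau_gen m i)" "k < dim_col (burau_gen m j * burau_gen m i)"
    then have rk: "r < m" "k < m" using c by auto
    have ne: "i - 1 \<noteq> i" "j - 1 \<noteq> j" "i - 1 \<noteq> j - 1" "i - 1 \<noteq> j" "i \<noteq> j - 1" "i \<noteq> j"
      and lt: "i - 1 < m" "i < m" "j - 1 < m" "j < m"
      using ij by auto
    note ix = burau_gen_mult_index[OF ij(1) c(2) _ rk(2)] burau_gen_mult_index[OF ij(2) c(1) _ rk(2)]
      burau_gen_index[OF ij(1) _ rk(2)] burau_gen_index[OF ij(2) _ rk(2)]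
    consider "r = i - 1" | "r = i" | "r = j - 1" | "r = j" | "r \<noteq> i - 1" "r \<noteq> i" "r \<noteq> j - 1" "r \<noteq> j"
      by blast
    then show "(burau_gen m i * burau_gen m j) $$ (r, k) = (burau_gen m j * burau_gen m i) $$ (r, k)"
      by cases (simp_all only: ix ne ne[symmetric] lt rk if_True if_False simp_thms, use ne in auto)
  qed (use c in auto)
  then show ?thesis using c
    by (simp add: uv GL_def units_of_mult units_of_one ring_mat_simps)
qed

lemma burau_hom: "burau m \<in> hom (braid_group m) (GL m)"
  unfolding burau_def braid_group_def
  by (rule presented_lift_hom[OF GL_group], erule burau_gen_GL, erule burau_braid_relations)

lemma burau_artin_gen: "i \<in> {1..<m} \<Longrightarrow> burau m (artin_gen m i) = burau_gen m i"
  unfolding burau_def artin_gen_def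
  by (rule presented_lift_gen[OF GL_group], erule burau_gen_GL, erule burau_braid_relations, assumption)

end

theory Submission
  imports Defs
begin

text \<open>Put \<open>t = 1\<close>: the Burau matrix of a braid \<open>b\<close> becomes the permutation matrix \<open>P\<close> of the
  permutation \<open>\<pi>\<close> of \<open>b\<close>. Let \<open>D\<close> be the derivative at \<open>t = 1\<close>. By the product rule
  \<open>E = D P\<^sup>-\<^sup>1\<close> is a cocycle, hence so is \<open>E - E\<^sup>T\<close>, and on the Artin generators this agrees with
  the coboundary \<open>P C P\<^sup>-\<^sup>1 - C\<close>, where \<open>C\<close> is the strictly upper triangular matrix of ones. So
  the two agree for all braids. If \<open>b\<close> is pure, then \<open>P = 1\<close>, \<open>E = D\<close> and the coboundary vanishes.\<close>

text \<open>A Laurent polynomial is a finite sum of monomials, and setting a coefficient at a fresh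
  exponent adds a monomial. Additive identities thus need checking only on monomials; zero is the
  monomial with coefficient 0.\<close>

lemma laurent_induct [case_names single add]:
  fixes p :: laurent
  assumes "\<And>k c. Q (Poly_Mapping.single k c)" and "\<And>p q. Q p \<Longrightarrow> Q q \<Longrightarrow> Q (p + q)"
  shows "Q p"
proof (induction p rule: update_induct)
  case const
  then show ?case using assms(1)[of 0 0] by simp
next
  case (update p k c)
  have "Poly_Mapping.update k c p = p + Poly_Mapping.single k c"
    using update by (intro poly_mapping_eqI) (auto simp: lookup_update lookup_add lookup_single in_keys_iff)
  then show ?case using update assms by simp
qed

lemma laurent_eval_1_diff: "laurent_eval_1 (p - q) = laurent_eval_1 p - laurent_eval_1 q"
  using laurent_eval_1_add[of "p - q" q] by simp

lemma laurent_deriv_diff: "laurent_deriv (p - q) = laurent_deriv p - laurent_deriv q"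
  using laurent_deriv_add[of "p - q" q] by simp

lemma laurent_eval_1_t_mult: "laurent_eval_1 (laurent_t * p) = laurent_eval_1 p"
  by (induction p rule: laurent_induct)
    (simp_all add: laurent_t_def mult_single laurent_eval_1_single distrib_left laurent_eval_1_add)

text \<open>The entries of a generator are \<open>1 - laurent_t\<close>, \<open>laurent_t\<close>, 1
  and 0, so this instance of the product rule is enough.\<close>

lemma laurent_eval_1_deriv_t_mult:
  "laurent_eval_1 (laurent_deriv (laurent_t * p)) = laurent_eval_1 p + laurent_eval_1 (laurent_deriv p)"
  by (induction p rule: laurent_induct)
    (simp_all add: laurent_t_def mult_single laurent_eval_1_single laurent_deriv_single distrib_left
      distrib_right laurent_eval_1_add laurent_deriv_add)

text \<open>Matrices have rows and columns \<open>0, \<dots>, m - 1\<close>, permutations act on \<open>1, \<dots>, m\<close>.\<close>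

definition val1 :: "laurent mat \<Rightarrow> nat \<Rightarrow> nat \<Rightarrow> int" where
  "val1 A r c = laurent_eval_1 (A $$ (r - 1, c - 1))"

definition der1 :: "laurent mat \<Rightarrow> nat \<Rightarrow> nat \<Rightarrow> int" where
  "der1 A r c = laurent_eval_1 (laurent_deriv (A $$ (r - 1, c - 1)))"

text \<open>The last conjunct is the identity \<open>E - E\<^sup>T = P C P\<^sup>-\<^sup>1 - C\<close> at the entry \<open>(\<pi> c, \<pi> d)\<close>.\<close>

definition skew_coboundary :: "nat \<Rightarrow> laurent mat \<Rightarrow> (nat \<Rightarrow> nat) \<Rightarrow> bool" where
  "skew_coboundary m A \<pi> \<longleftrightarrow>
     (\<forall>r\<in>{1..m}. \<forall>c\<in>{1..m}. val1 A r c = of_bool (r = \<pi> c)) \<and>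
     (\<forall>c\<in>{1..m}. \<forall>d\<in>{1..m}. der1 A (\<pi> c) d - der1 A (\<pi> d) c = of_bool (c < d) - of_bool (\<pi> c < \<pi> d))"

text \<open>At \<open>t = 1\<close> the block of a generator becomes that of a transposition, so
  multiplying by it on the left only permutes rows.\<close>

lemma val1_burau_gen_mult:
  assumes i: "i \<in> {1..<m}" and A: "A \<in> carrier_mat m m" and r: "r \<in> {1..m}" and c: "c \<in> {1..m}"
  shows "val1 (burau_gen m i * A) (Transposition.transpose i (i + 1) r) c = val1 A r c"
proof -
  have *: "k - 1 < m" "c - 1 < m" if "k \<in> {1..m}" for k using that c by auto
  have ne: "i - 1 \<noteq> i" using i by auto
  have "i \<in> {1..m}" "i + 1 \<in> {1..m}" using i by auto
  note ix = burau_gen_mult_index[OF i A *[OF this(1)]] burau_gen_mult_index[OF i A *[OF this(2)]]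
    burau_gen_mult_index[OF i A *[OF r]]
  consider "r = i" | "r = i + 1" | "r \<noteq> i" "r \<noteq> i + 1" by blast
  then show ?thesis
  proof cases
    case 3
    moreover have "r - 1 \<noteq> i - 1" "r - 1 \<noteq> i" using 3 r i by auto
    ultimately show ?thesis using ix(3) by (simp add: val1_def)
  qed (use ix ne in \<open>simp_all add: val1_def left_diff_distrib laurent_eval_1_add laurent_eval_1_diff
        laurent_eval_1_t_mult del: index_mult_mat\<close>)
qed

text \<open>Product rule at \<open>t = 1\<close>: the derivative of the generator is zero except for
  -1 at \<open>(i, i)\<close> and 1 at \<open>(i + 1, i)\<close>, counting from 1. Hence the
  correction involves only row \<open>i\<close> of \<open>A\<close>.\<close>

lemma der1_burau_gen_mult:
  assumes i: "i \<in> {1..<m}" and A: "A \<in> carrier_mat m m" and r: "r \<in> {1..m}" and c: "c \<in> {1..m}"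
  shows "der1 (burau_gen m i * A) (Transposition.transpose i (i + 1) r) c
    = der1 A r c + (of_bool (r = i) - of_bool (r = i + 1)) * val1 A i c"
proof -
  have *: "k - 1 < m" "c - 1 < m" if "k \<in> {1..m}" for k using that c by auto
  have ne: "i - 1 \<noteq> i" using i by auto
  have "i \<in> {1..m}" "i + 1 \<in> {1..m}" using i by auto
  note ix = burau_gen_mult_index[OF i A *[OF this(1)]] burau_gen_mult_index[OF i A *[OF this(2)]]
    burau_gen_mult_index[OF i A *[OF r]]
  consider "r = i" | "r = i + 1" | "r \<noteq> i" "r \<noteq> i + 1" by blast
  then show ?thesis
  proof cases
    case 3
    moreover have "r - 1 \<noteq> i - 1" "r - 1 \<noteq> i" using 3 r i by auto
    ultimately show ?thesis using ix(3) by (simp add: der1_def)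
  qed (use ix ne in \<open>simp_all add: val1_def der1_def left_diff_distrib laurent_eval_1_add
        laurent_eval_1_diff laurent_deriv_add laurent_deriv_diff
        laurent_eval_1_deriv_t_mult del: index_mult_mat\<close>)
qed

text \<open>Swapping two neighbouring numbers reverses the order of that pair and of no
  other.\<close>

lemma less_transpose_adjacent:
  "of_bool (Transposition.transpose i (i + 1) p < Transposition.transpose i (i + 1) q)
    = (of_bool (p < q) - of_bool (p = i \<and> q = i + 1) + of_bool (p = i + 1 \<and> q = i) :: int)"
  for i p q :: nat
  by (auto simp: Transposition.transpose_def)

text \<open>An equivalence, so that it serves for a generator and for its inverse.\<close>

lemma skew_coboundary_burau_gen_mult:
  assumes i: "i \<in> {1..<m}" and A: "A \<in> carrier_mat m m" and \<pi>: "\<pi> permutes {1..m}"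
  shows "skew_coboundary m (burau_gen m i * A) (Transposition.transpose i (i + 1) \<circ> \<pi>)
    \<longleftrightarrow> skew_coboundary m A \<pi>"
proof -
  let ?s = "Transposition.transpose i (i + 1)" and ?B = "burau_gen m i * A"
  have s: "?s permutes {1..m}" using i by (intro permutes_swap_id) auto
  have inS: "\<pi> c \<in> {1..m}" if "c \<in> {1..m}" for c using permutes_in_image[OF \<pi>] that by simp
  have val: "(\<forall>r\<in>{1..m}. \<forall>c\<in>{1..m}. val1 ?B r c = of_bool (r = ?s (\<pi> c))) \<longleftrightarrow>
      (\<forall>r\<in>{1..m}. \<forall>c\<in>{1..m}. val1 A r c = of_bool (r = \<pi> c))"
  proof -
    \<comment> \<open>Reindexing the rows by \<open>?s\<close> brings them into the form of
      \<open>val1_burau_gen_mult\<close>.\<close>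
    have "(\<forall>r\<in>{1..m}. \<forall>c\<in>{1..m}. val1 ?B r c = of_bool (r = ?s (\<pi> c))) \<longleftrightarrow>
      (\<forall>r\<in>?s ` {1..m}. \<forall>c\<in>{1..m}. val1 ?B r c = of_bool (r = ?s (\<pi> c)))"
      unfolding permutes_image[OF s] ..
    also have "\<dots> \<longleftrightarrow> (\<forall>r\<in>{1..m}. \<forall>c\<in>{1..m}. val1 ?B (?s r) c = of_bool (?s r = ?s (\<pi> c)))"
      by blast
    also have "\<dots> \<longleftrightarrow> (\<forall>r\<in>{1..m}. \<forall>c\<in>{1..m}. val1 A r c = of_bool (r = \<pi> c))"
      by (intro ball_cong) (simp_all only: val1_burau_gen_mult[OF i A] inj_eq[OF permutes_inj[OF s]])
    finally show ?thesis .
  qed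
  have der: "der1 ?B (?s (\<pi> c)) d - der1 ?B (?s (\<pi> d)) c = of_bool (c < d) - of_bool (?s (\<pi> c) < ?s (\<pi> d))
      \<longleftrightarrow> der1 A (\<pi> c) d - der1 A (\<pi> d) c = of_bool (c < d) - of_bool (\<pi> c < \<pi> d)"
    if val: "\<forall>r\<in>{1..m}. \<forall>c\<in>{1..m}. val1 A r c = of_bool (r = \<pi> c)"
      and cd: "c \<in> {1..m}" "d \<in> {1..m}" for c d
  proof -
    have "i \<in> {1..m}" using i by auto
    then have v: "val1 A i c = of_bool (i = \<pi> c)" "val1 A i d = of_bool (i = \<pi> d)"
      using val cd by auto
    \<comment> \<open>Antisymmetrizing cancels the products of \<open>of_bool (\<pi> c = i)\<close>
      and \<open>of_bool (\<pi> d = i)\<close>. What remains concerns the values \<open>i\<close>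
      and \<open>i + 1\<close> and is exactly the change in
      \<open>of_bool (\<pi> c < \<pi> d)\<close>.\<close>
    show ?thesis
      unfolding der1_burau_gen_mult[OF i A inS[OF cd(1)] cd(2)]
        der1_burau_gen_mult[OF i A inS[OF cd(2)] cd(1)] v less_transpose_adjacent
      by auto
  qed
  show ?thesis
    unfolding skew_coboundary_def comp_apply
    \<comment> \<open>\<open>conj_cong\<close> supplies the values of \<open>A\<close> at
      \<open>t = 1\<close>, on which \<open>der\<close> depends.\<close>
    by (rule conj_cong[OF val], intro ball_cong, simp_all only: der)
qed

lemma GL_mult: "A \<otimes>\<^bsub>GL m\<^esub> B = A * B"
  by (simp add: GL_def units_of_mult ring_mat_simps)

lemma GL_carrier_mat: "A \<in> carrier (GL m) \<Longrightarrow> A \<in> carrier_mat m m"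
  by (auto simp: GL_def units_of_carrier Units_def ring_mat_simps)

lemma skew_coboundary_gword:
  assumes "w \<in> gwords {1..<m}"
  shows "skew_coboundary m (gword_eval (GL m) (burau_gen m) w)
    (gword_eval (sym_group m) (\<lambda>i. Transposition.transpose i (i + 1)) w)"
  using assms
proof (induction w)
  case Nil
  have "val1 (1\<^sub>m m) r c = of_bool (r = c)" "der1 (1\<^sub>m m) r c = 0"
    if "r \<in> {1..m}" "c \<in> {1..m}" for r c
    using that laurent_eval_1_single[of 0 1] laurent_deriv_single[of 0 1]
    by (auto simp: val1_def der1_def laurent_eval_1_def laurent_deriv_def)
  then show ?case
    by (simp add: skew_coboundary_def GL_def units_of_one ring_mat_simps sym_group_one)
next
  case (Cons l w)
  obtain i e where l: "l = (i, e)" by force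
  have i: "i \<in> {1..<m}" and w: "w \<in> gwords {1..<m}"
    using Cons.prems l by (auto simp: gwords_def)
  let ?t = "\<lambda>i. Transposition.transpose i (i + 1)"
  let ?A = "gword_eval (GL m) (burau_gen m) w" and ?p = "gword_eval (sym_group m) ?t w"
  let ?B = "gword_eval (GL m) (burau_gen m) (l # w)" and ?q = "gword_eval (sym_group m) ?t (l # w)"
  interpret GL: group "GL m" by (rule GL_group)
  interpret S: group "sym_group m" by (rule sym_group_is_group)
  have cl: "?A \<in> carrier (GL m)" "?B \<in> carrier (GL m)"
      "?p \<in> carrier (sym_group m)" "?q \<in> carrier (sym_group m)"
    by (rule gword_eval_closed[where X = "{1..<m}"],
        fact GL_group sym_group_is_group,
        erule burau_gen_GL transpose_in_sym_group, fact w Cons.prems)+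
  note gen = burau_gen_GL[OF i] transpose_in_sym_group[OF i]
  note step = skew_coboundary_burau_gen_mult[OF i]
  show ?case
  proof (cases e)
    case True
    then have "burau_gen m i * ?A = ?B" "?t i \<circ> ?p = ?q"
      by (simp_all add: l GL_mult sym_group_mult)
    moreover have "skew_coboundary m (burau_gen m i * ?A) (?t i \<circ> ?p)"
      using step[OF GL_carrier_mat[OF cl(1)]] cl(3) Cons.IH[OF w] sym_group_carrier by blast
    ultimately show ?thesis by (simp only:)
  next
    case False
    \<comment> \<open>For an inverse letter, the generator times the new matrix is the old one, so
      the equivalence is read from left to right and no inverse matrix is computed.\<close>
    then have "burau_gen m i \<otimes>\<^bsub>GL m\<^esub> ?B = ?A" "?t i \<otimes>\<^bsub>sym_group m\<^esub> ?q = ?p"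
      using gen cl S.r_inv[OF gen(2)] by (simp_all add: l flip: GL.m_assoc S.m_assoc)
    then have "burau_gen m i * ?B = ?A" "?t i \<circ> ?q = ?p"
      by (simp_all only: GL_mult sym_group_mult)
    then have "skew_coboundary m (burau_gen m i * ?B) (?t i \<circ> ?q)"
      using Cons.IH[OF w] by (simp only:)
    then show ?thesis
      using step[OF GL_carrier_mat[OF cl(2)]] cl(4) sym_group_carrier by blast
  qed
qed

theorem corollary2:
  fixes m :: nat and b :: "nat gword set"
  assumes "1 \<le> m" and "b \<in> pure_braid_group m"
  shows "transpose_mat (map_mat laurent_eval_1 (map_mat laurent_deriv (burau m b)))
       = map_mat laurent_eval_1 (map_mat laurent_deriv (burau m b))"
proof -
  let ?t = "\<lambda>i. Transposition.transpose i (i + 1)"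
  have b: "b \<in> carrier (braid_group m)" "braid_perm m b = id"
    using assms(2) by (auto simp: pure_braid_group_def kernel_def sym_group_one)
  then obtain w where w: "w \<in> gwords {1..<m}"
    and bw: "b = pres_cong {1..<m} (braid_relations m) `` {w}"
    by (auto simp: braid_group_def presented_group_carrier_iff)
  \<comment> \<open>Both lifts are evaluated on the same word \<open>w\<close>, so that its matrix
    and its permutation can be compared.\<close>
  have f: "burau m b = gword_eval (GL m) (burau_gen m) w"
    unfolding burau_def bw
    by (rule presented_lift_class[OF GL_group], erule burau_gen_GL, erule burau_braid_relations, rule w)
  have p: "braid_perm m b = gword_eval (sym_group m) ?t w"
    unfolding braid_perm_def bw
    by (rule presented_lift_class[OF sym_group_is_group], erule transpose_in_sym_group,
        erule transpose_braid_relations, rule w)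
  have "burau m b \<in> carrier_mat m m"
    using b(1) burau_hom[of m] GL_carrier_mat by (auto simp: hom_def)
  moreover have "skew_coboundary m (burau m b) id"
    using skew_coboundary_gword[OF w] f p b(2) by simp
  \<comment> \<open>For the identity permutation the two order indicators cancel. \<open>Suc\<close>
    passes from matrix indices to \<open>1, ..., m\<close>.\<close>
  then have "der1 (burau m b) (Suc r) (Suc c) = der1 (burau m b) (Suc c) (Suc r)"
    if "r < m" "c < m" for r c
    using that unfolding skew_coboundary_def by fastforce
  ultimately show ?thesis
    by (intro eq_matI) (auto simp: der1_def)
qed

end
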